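(* Let $L$ be a random variable with values in $\{0,1,2,\dots\}$ whose mean $m := \mathbf{E}[L]$ satisfies $0<m<\infty$, and let $(Z_n)_{n\ge 0}$ be the Galton-Watson branching process with offspring variable $L$ and $Z_0=1$. Then the sequence $\{\mathbf{P}[Z_n>0]/m^n\}_{n\ge 0}$ is decreasing (that is, nonincreasing). If moreover $m<1$, then the following are equivalent: (i) $\lim_{n\to\infty} \mathbf{P}[Z_n>0]/m^n > 0$; (ii) $\sup_n \mathbf{E}[Z_n \mid Z_n>0] < \infty$; (iii) $\mathbf{E}[L\log^+ L]<\infty$.
   Context: Galton-Watson process: $Z_0=1$ and $Z_{n+1}=\sum_{i=1}^{Z_n} L_{n,i}$, where the $L_{n,i}$ are i.i.d. copies of $L$ (each particle in generation $n$ independently has a number of children distributed as $L$). Notation: $\log^+ x := \max(\log x, 0)$ for $x>0$, and $0\log^+ 0 := 0$. *)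

theory Defs
  imports "HOL-Probability.Probability"
begin

text \<open>
  \<open>X n i \<omega>\<close> is the number of children of the \<open>i\<close>-th particle (counted from \<open>0\<close>) of
  generation \<open>n\<close>.
\<close>

primrec galton_watson :: "(nat \<Rightarrow> nat \<Rightarrow> 'a \<Rightarrow> nat) \<Rightarrow> nat \<Rightarrow> 'a \<Rightarrow> nat" where
  "galton_watson X 0 \<omega> = 1"
| "galton_watson X (Suc n) \<omega> = (\<Sum>i<galton_watson X n \<omega>. X n i \<omega>)"

definition iid_copies ::
  "'a measure \<Rightarrow> (nat \<Rightarrow> nat \<Rightarrow> 'a \<Rightarrow> nat) \<Rightarrow> 'b measure \<Rightarrow> ('b \<Rightarrow> nat) \<Rightarrow> bool" where
  "iid_copies M X N L \<longleftrightarrow>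
     prob_space.indep_vars M (\<lambda>_. count_space UNIV) (\<lambda>(n, i). X n i) (UNIV :: (nat \<times> nat) set) \<and>
     (\<forall>n i. distr M (count_space UNIV) (X n i) = distr N (count_space UNIV) L)"

text \<open>
  The values at \<open>x \<le> 0\<close> are irrelevant: only \<open>x * log_plus x\<close> with \<open>x \<ge> 0\<close> is used, which
  is \<open>0\<close> at \<open>x = 0\<close>.
\<close>

definition log_plus :: "real \<Rightarrow> real" where
  "log_plus x = max (ln x) 0"

text \<open>
  Expectation of a nonnegative variable conditioned on an event of positive probability, with
  values in \<open>[0, \<infinity>]\<close>: the integral with respect to the conditional measure \<open>P (\<cdot> | A)\<close>.
\<close>

definition cond_nn_expectation :: "'a measure \<Rightarrow> ('a \<Rightarrow> ennreal) \<Rightarrow> ('a \<Rightarrow> bool) \<Rightarrow> ennreal" where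
  "cond_nn_expectation M Y A = (\<integral>\<^sup>+\<omega>. Y \<omega> \<partial>uniform_measure M {\<omega> \<in> space M. A \<omega>})"

end

theory Submission
  imports Defs
begin

text \<open>
  Let \<open>q\<^sub>n = P(Z\<^sub>n > 0)\<close> and \<open>a = P(L > 0)\<close>. The generating function of \<open>Z\<^sub>n\<close> is the \<open>n\<close>-th iterate
  of \<open>s \<mapsto> E s\<^sup>L\<close>, and \<open>1 - (1 - x)\<^sup>l = x (l - \<Sum>j<l. (1 - (1 - x)\<^sup>j))\<close>, so
  \<open>q\<^sub>n\<^sub>+\<^sub>1 = q\<^sub>n (m - h(q\<^sub>n))\<close> with \<open>h(x) = E (\<Sum>j<L. (1 - (1 - x)\<^sup>j)) \<ge> 0\<close>; hence \<open>q\<^sub>n / m\<^sup>n\<close>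
  decreases. Since \<open>E Z\<^sub>n = m\<^sup>n\<close>, the conditional mean in (ii) is the reciprocal of \<open>q\<^sub>n / m\<^sup>n\<close>, and
  (i) and (ii) both say that the product of the factors \<open>1 - h(q\<^sub>k) / m\<close> is positive, that is,
  \<open>\<Sum>k. h(q\<^sub>k) < \<infinity>\<close>. As \<open>h\<close> is increasing and \<open>a\<^sup>k \<le> q\<^sub>k \<le> m\<^sup>k\<close>, it remains to see that for
  every \<open>\<rho>\<close> in \<open>(0, 1)\<close> the sum \<open>\<Sum>k. h(\<rho>\<^sup>k)\<close> is finite iff \<open>E L log\<^sup>+ L < \<infinity>\<close>. This holds
  because \<open>\<Sum>j<l. (1 - (1 - x)\<^sup>j)\<close> is at most \<open>l min(1, l x)\<close>, and at least \<open>l / 2\<close> when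
  \<open>l x \<ge> 2\<close>, so that its sum over \<open>x = \<rho>\<^sup>k\<close> is of order \<open>l log l\<close>.
\<close>

subsection \<open>Random sums and the Galton-Watson recursion\<close>

text \<open>Measurability is assumed only for the rows below \<open>n\<close>, so that the lemma
  also applies on a product space that carries just those coordinates.\<close>

lemma galton_watson_measurable:
  assumes "\<And>j i. j < n \<Longrightarrow> X j i \<in> M \<rightarrow>\<^sub>M count_space UNIV"
  shows "galton_watson X n \<in> M \<rightarrow>\<^sub>M count_space UNIV"
  using assms
proof (induction n)
  case 0
  then show ?case by (simp add: galton_watson.simps(1)[abs_def])
next
  case (Suc n)
  have [measurable]: "galton_watson X n \<in> M \<rightarrow>\<^sub>M count_space UNIV"
    using Suc by simp
  have [measurable]: "X n i \<in> M \<rightarrow>\<^sub>M count_space UNIV" for i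
    using Suc.prems by simp
  have "(\<lambda>\<omega>. \<Sum>i<galton_watson X n \<omega>. X n i \<omega>) \<in> M \<rightarrow>\<^sub>M count_space UNIV"
    by (rule measurable_compose_countable[where f = "\<lambda>k \<omega>. \<Sum>i<k. X n i \<omega>"]) simp_all
  then show ?case
    by (simp add: galton_watson.simps(2)[abs_def])
qed

text \<open>The points \<open>x\<close> and \<open>y\<close> may lie in different spaces: this
  compares the process on \<open>M\<close> with the one built from the coordinates of a product
  space.\<close>

lemma galton_watson_cong:
  assumes "\<And>j i. j < n \<Longrightarrow> X j i x = Y j i y"
  shows "galton_watson X n x = galton_watson Y n y"
  using assms by (induction n) auto

text \<open>Generation \<open>n\<close> is a function of the rows before \<open>n\<close>, so it and
  the entries of row \<open>n\<close> depend on disjoint blocks \<open>K k\<close> of the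
  independent family. The index \<open>None\<close> stands for the generation size and
  \<open>Some i\<close> for its \<open>i\<close>-th particle.\<close>

lemma (in prob_space) indep_vars_galton_watson_row:
  assumes "indep_vars (\<lambda>_. count_space UNIV) (\<lambda>(n, i). X n i) (UNIV :: (nat \<times> nat) set)"
  shows "indep_vars (\<lambda>_. count_space UNIV) (case_option (galton_watson X n) (X n)) UNIV"
proof -
  define K :: "nat option \<Rightarrow> (nat \<times> nat) set"
    where "K = case_option ({..<n} \<times> UNIV) (\<lambda>i. {(n, i)})"
  define G :: "nat option \<Rightarrow> (nat \<times> nat \<Rightarrow> nat) \<Rightarrow> nat"
    where "G = case_option (galton_watson (\<lambda>j i x. x (j, i)) n) (\<lambda>i x. x (n, i))"
  have disj: "disjoint_family_on K UNIV"
    by (auto simp: disjoint_family_on_def K_def split: option.splits)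
  have "G k \<in> PiM (K k) (\<lambda>_. count_space UNIV) \<rightarrow>\<^sub>M count_space UNIV" for k
  proof (cases k)
    case None
    then show ?thesis
      by (auto simp: G_def K_def intro!: galton_watson_measurable measurable_component_singleton)
  next
    case (Some i)
    then show ?thesis
      by (auto simp: G_def K_def intro!: measurable_component_singleton)
  qed
  then have "indep_vars (\<lambda>_. count_space UNIV)
      (\<lambda>k \<omega>. G k (restrict (\<lambda>p. (case p of (n, i) \<Rightarrow> X n i) \<omega>) (K k))) UNIV"
    by (intro indep_vars_compose2[OF indep_vars_restrict[OF assms _ disj]]) auto
  also have "(\<lambda>k \<omega>. G k (restrict (\<lambda>p. (case p of (n, i) \<Rightarrow> X n i) \<omega>) (K k)))
      = case_option (galton_watson X n) (X n)"
    by (intro ext) (auto simp: G_def K_def intro!: galton_watson_cong split: option.splits)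
  finally show ?thesis .
qed

lemma nn_integral_eq_if_distr_eq:
  assumes "distr M (count_space UNIV) Y = distr N (count_space UNIV) L"
    and [measurable]: "Y \<in> M \<rightarrow>\<^sub>M count_space UNIV" "L \<in> N \<rightarrow>\<^sub>M count_space UNIV"
  shows "(\<integral>\<^sup>+\<omega>. g (Y \<omega>) \<partial>M) = (\<integral>\<^sup>+\<omega>. g (L \<omega>) \<partial>N)"
  using arg_cong[OF assms(1), of "\<lambda>D. \<integral>\<^sup>+k. g k \<partial>D"] by (simp add: nn_integral_distr)

section \<open>Transforms of a sum with a random number of terms\<close>

context prob_space
begin

context
  fixes Z :: "'a \<Rightarrow> nat" and Y :: "nat \<Rightarrow> 'a \<Rightarrow> nat" and N :: "'b measure" and L :: "'b \<Rightarrow> nat"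
  assumes indep: "indep_vars (\<lambda>_. count_space UNIV) (case_option Z Y) UNIV"
    and ident: "\<And>i. distr M (count_space UNIV) (Y i) = distr N (count_space UNIV) L"
    and L [measurable]: "L \<in> N \<rightarrow>\<^sub>M count_space UNIV"
begin

lemma random_sum_measurable [measurable]:
  "Z \<in> M \<rightarrow>\<^sub>M count_space UNIV" "Y i \<in> M \<rightarrow>\<^sub>M count_space UNIV"
  using indep unfolding indep_vars_def by (metis UNIV_I option.case)+

lemma borel_measurable_random_sum:
  fixes g :: "nat \<Rightarrow> ennreal"
  shows "(\<lambda>\<omega>. g (Z \<omega>)) \<in> borel_measurable M" "(\<lambda>\<omega>. g (Y i \<omega>)) \<in> borel_measurable M"
  by (rule measurable_compose[OF random_sum_measurable(1)], simp)
    (rule measurable_compose[OF random_sum_measurable(2)], simp)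

text \<open>With \<open>u\<close> the indicator of a set of values of \<open>Z\<close>, this
  decouples the number of summands from the summands themselves.\<close>

lemma nn_integral_prod_Z_Y:
  fixes u :: "nat \<Rightarrow> ennreal" and v :: "nat \<Rightarrow> ennreal"
  assumes "finite I"
  shows "(\<integral>\<^sup>+\<omega>. u (Z \<omega>) * (\<Prod>i\<in>I. v (Y i \<omega>)) \<partial>M)
       = (\<integral>\<^sup>+\<omega>. u (Z \<omega>) \<partial>M) * (\<integral>\<^sup>+\<omega>. v (L \<omega>) \<partial>N) ^ card I"
proof -
  define W where "W = case_option (\<lambda>\<omega>. u (Z \<omega>)) (\<lambda>i \<omega>. v (Y i \<omega>))"
  have "indep_vars (\<lambda>_. borel) (\<lambda>k \<omega>. (case k of None \<Rightarrow> u | Some i \<Rightarrow> v) (case_option Z Y k \<omega>)) UNIV"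
    by (rule indep_vars_compose2[OF indep]) simp
  also have "(\<lambda>k \<omega>. (case k of None \<Rightarrow> u | Some i \<Rightarrow> v) (case_option Z Y k \<omega>)) = W"
    by (auto simp: W_def fun_eq_iff split: option.splits)
  finally have "indep_vars (\<lambda>_. borel) W (insert None (Some ` I))"
    by (rule indep_vars_subset) simp
  then have "(\<integral>\<^sup>+\<omega>. (\<Prod>k\<in>insert None (Some ` I). W k \<omega>) \<partial>M)
      = (\<Prod>k\<in>insert None (Some ` I). \<integral>\<^sup>+\<omega>. W k \<omega> \<partial>M)"
    using assms by (intro indep_vars_nn_integral) auto
  moreover have "(\<integral>\<^sup>+\<omega>. v (Y i \<omega>) \<partial>M) = (\<integral>\<^sup>+\<omega>. v (L \<omega>) \<partial>N)" for i
    by (rule nn_integral_eq_if_distr_eq[OF ident]) simp_all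
  ultimately show ?thesis
    using assms by (simp add: W_def prod.reindex)
qed

text \<open>Where \<open>Z\<close> equals \<open>k\<close>, the power is a product of
  \<open>k\<close> i.i.d. factors that are independent of \<open>Z\<close>; summing over
  \<open>k\<close> gives the claim. Values in \<open>ennreal\<close> make every interchange of sum
  and integral free of integrability conditions.\<close>

lemma nn_integral_power_random_sum:
  fixes s :: ennreal
  shows "(\<integral>\<^sup>+\<omega>. s ^ (\<Sum>i<Z \<omega>. Y i \<omega>) \<partial>M) = (\<integral>\<^sup>+\<omega>. (\<integral>\<^sup>+\<omega>. s ^ L \<omega> \<partial>N) ^ Z \<omega> \<partial>M)"
proof -
  have split: "g (Z \<omega>) = (\<Sum>k. indicator {k} (Z \<omega>) * g k)" for g :: "nat \<Rightarrow> ennreal" and \<omega>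
    by (subst suminf_finite[of "{Z \<omega>}"]) (auto simp: indicator_def)
  have "(\<integral>\<^sup>+\<omega>. s ^ (\<Sum>i<Z \<omega>. Y i \<omega>) \<partial>M)
      = (\<integral>\<^sup>+\<omega>. (\<Sum>k. indicator {k} (Z \<omega>) * (\<Prod>i<k. s ^ Y i \<omega>)) \<partial>M)"
    by (subst power_sum, subst split[of "\<lambda>k. \<Prod>i<k. s ^ Y i \<omega>" \<omega> for \<omega>]) (rule refl)
  also have "\<dots> = (\<Sum>k. \<integral>\<^sup>+\<omega>. indicator {k} (Z \<omega>) * (\<Prod>i<k. s ^ Y i \<omega>) \<partial>M)"
    by (intro nn_integral_suminf borel_measurable_times_ennreal borel_measurable_prod_ennreal
        borel_measurable_random_sum)
  also have "\<dots> = (\<Sum>k. \<integral>\<^sup>+\<omega>. indicator {k} (Z \<omega>) * (\<integral>\<^sup>+\<omega>. s ^ L \<omega> \<partial>N) ^ k \<partial>M)"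
    by (subst nn_integral_prod_Z_Y) (simp_all add: nn_integral_multc[OF borel_measurable_random_sum(1)[of "indicator A" for A]])
  also have "\<dots> = (\<integral>\<^sup>+\<omega>. (\<Sum>k. indicator {k} (Z \<omega>) * (\<integral>\<^sup>+\<omega>. s ^ L \<omega> \<partial>N) ^ k) \<partial>M)"
    by (intro nn_integral_suminf [symmetric] borel_measurable_times_ennreal
        borel_measurable_random_sum borel_measurable_const)
  also have "\<dots> = (\<integral>\<^sup>+\<omega>. (\<integral>\<^sup>+\<omega>. s ^ L \<omega> \<partial>N) ^ Z \<omega> \<partial>M)"
    by (subst split[of "\<lambda>k. (\<integral>\<^sup>+\<omega>. s ^ L \<omega> \<partial>N) ^ k", symmetric]) (rule refl)
  finally show ?thesis .
qed

text \<open>This is Wald's identity: the \<open>i\<close>-th term is counted exactly when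
  \<open>i < Z\<close>, an event independent of \<open>Y i\<close>, and the indicators of these
  events add up to \<open>Z\<close>.\<close>

lemma nn_integral_random_sum:
  "(\<integral>\<^sup>+\<omega>. of_nat (\<Sum>i<Z \<omega>. Y i \<omega>) \<partial>M)
     = (\<integral>\<^sup>+\<omega>. of_nat (Z \<omega>) \<partial>M) * (\<integral>\<^sup>+\<omega>. of_nat (L \<omega>) \<partial>N)"
proof -
  have split: "(\<Sum>i<Z \<omega>. g i) = (\<Sum>i. indicator {i<..} (Z \<omega>) * g i)"
    for g :: "nat \<Rightarrow> ennreal" and \<omega>
    by (subst suminf_finite[of "{..<Z \<omega>}"]) (auto simp: indicator_def)
  have "(\<integral>\<^sup>+\<omega>. of_nat (\<Sum>i<Z \<omega>. Y i \<omega>) \<partial>M)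
      = (\<integral>\<^sup>+\<omega>. (\<Sum>i. indicator {i<..} (Z \<omega>) * of_nat (Y i \<omega>)) \<partial>M)"
    by (simp add: split)
  also have "\<dots> = (\<Sum>i. \<integral>\<^sup>+\<omega>. indicator {i<..} (Z \<omega>) * of_nat (Y i \<omega>) \<partial>M)"
    by (intro nn_integral_suminf borel_measurable_times_ennreal borel_measurable_prod_ennreal
        borel_measurable_random_sum)
  also have "\<dots> = (\<Sum>i. \<integral>\<^sup>+\<omega>. indicator {i<..} (Z \<omega>) * (\<integral>\<^sup>+\<omega>. of_nat (L \<omega>) \<partial>N) \<partial>M)"
    using nn_integral_prod_Z_Y[of "{i}" "indicator {i<..}" of_nat for i]
    by (simp add: nn_integral_multc[OF borel_measurable_random_sum(1)[of "indicator A" for A]])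
  also have "\<dots> = (\<integral>\<^sup>+\<omega>. (\<Sum>i. indicator {i<..} (Z \<omega>) * (\<integral>\<^sup>+\<omega>. of_nat (L \<omega>) \<partial>N)) \<partial>M)"
    by (intro nn_integral_suminf [symmetric] borel_measurable_times_ennreal
        borel_measurable_random_sum borel_measurable_const)
  also have "\<dots> = (\<integral>\<^sup>+\<omega>. of_nat (Z \<omega>) * (\<integral>\<^sup>+\<omega>. of_nat (L \<omega>) \<partial>N) \<partial>M)"
    by (simp add: split[of "\<lambda>_. 1", simplified, symmetric])
  finally show ?thesis
    by (simp add: nn_integral_multc)
qed

end

end

section \<open>Generating function and mean of the \<open>n\<close>-th generation\<close>

lemma galton_watson_pgf:
  fixes s :: ennreal
  assumes "prob_space M" and "iid_copies M X N L" and "L \<in> N \<rightarrow>\<^sub>M count_space UNIV"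
  shows "(\<integral>\<^sup>+\<omega>. s ^ galton_watson X n \<omega> \<partial>M) = ((\<lambda>t. \<integral>\<^sup>+\<omega>. t ^ L \<omega> \<partial>N) ^^ n) s"
proof (induction n arbitrary: s)
  case 0
  then show ?case
    using assms(1) by (simp add: prob_space.emeasure_space_1)
next
  case (Suc n)
  interpret prob_space M by fact
  \<comment> \<open>Averaging over the last row replaces \<open>s\<close> by the offspring
    generating function at \<open>s\<close>; the induction hypothesis is then used at this new
    argument.\<close>
  have "(\<integral>\<^sup>+\<omega>. s ^ galton_watson X (Suc n) \<omega> \<partial>M)
      = (\<integral>\<^sup>+\<omega>. (\<integral>\<^sup>+\<omega>. s ^ L \<omega> \<partial>N) ^ galton_watson X n \<omega> \<partial>M)"
    unfolding galton_watson.simps using assms(2,3)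
    by (intro nn_integral_power_random_sum indep_vars_galton_watson_row) (auto simp: iid_copies_def)
  then show ?case
    by (simp only: Suc.IH funpow_Suc_right o_apply)
qed

lemma nn_integral_galton_watson:
  assumes "prob_space M" and "iid_copies M X N L" and "L \<in> N \<rightarrow>\<^sub>M count_space UNIV"
  shows "(\<integral>\<^sup>+\<omega>. of_nat (galton_watson X n \<omega>) \<partial>M) = (\<integral>\<^sup>+\<omega>. of_nat (L \<omega>) \<partial>N) ^ n"
proof (induction n)
  case 0
  then show ?case
    using assms(1) by (simp add: prob_space.emeasure_space_1)
next
  case (Suc n)
  interpret prob_space M by fact
  have "(\<integral>\<^sup>+\<omega>. of_nat (galton_watson X (Suc n) \<omega>) \<partial>M)
      = (\<integral>\<^sup>+\<omega>. of_nat (galton_watson X n \<omega>) \<partial>M) * (\<integral>\<^sup>+\<omega>. of_nat (L \<omega>) \<partial>N)"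
    unfolding galton_watson.simps using assms(2,3)
    by (intro nn_integral_random_sum indep_vars_galton_watson_row) (auto simp: iid_copies_def)
  then show ?case
    by (simp add: Suc.IH mult.commute)
qed

subsection \<open>The defect of the generating function along geometric sequences\<close>

text \<open>This is \<open>(l * x - (1 - (1 - x) ^ l)) / x\<close> with the division carried out, so
  that \<open>x = 0\<close> is no exception and bounds can be proved term by term.\<close>

definition pgf_defect :: "nat \<Rightarrow> real \<Rightarrow> real" where
  "pgf_defect l x = (\<Sum>j<l. 1 - (1 - x) ^ j)"

lemma mult_pgf_defect: "x * pgf_defect l x = real l * x - (1 - (1 - x) ^ l)"
  using one_diff_power_eq[of "1 - x" l]
  by (simp add: pgf_defect_def sum_subtractf right_diff_distrib mult.commute)

lemma pgf_defect_nonneg: "0 \<le> x \<Longrightarrow> x \<le> 1 \<Longrightarrow> 0 \<le> pgf_defect l x"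
  unfolding pgf_defect_def by (intro sum_nonneg) (simp add: power_le_one)

lemma pgf_defect_mono: "x \<le> y \<Longrightarrow> y \<le> 1 \<Longrightarrow> pgf_defect l x \<le> pgf_defect l y"
  unfolding pgf_defect_def by (intro sum_mono diff_left_mono power_mono) auto

lemma pgf_defect_le:
  assumes "x \<le> 1"
  shows "pgf_defect l x \<le> real l"
proof -
  have "pgf_defect l x \<le> (\<Sum>j<l. 1)"
    unfolding pgf_defect_def using assms by (intro sum_mono) simp
  then show ?thesis by simp
qed

lemma pgf_defect_le_square:
  assumes "0 \<le> x" "x \<le> 1"
  shows "pgf_defect l x \<le> real l * (real l * x)"
proof -
  have "1 - (1 - x) ^ j \<le> real l * x" if "j < l" for j
  proof -
    have "1 - (1 - x) ^ j \<le> real j * x"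
      using Bernoulli_inequality[of "- x" j] assms by simp
    also have "\<dots> \<le> real l * x"
      using that assms by (intro mult_right_mono) auto
    finally show ?thesis .
  qed
  then have "pgf_defect l x \<le> (\<Sum>j<l. real l * x)"
    unfolding pgf_defect_def by (intro sum_mono) simp
  then show ?thesis by simp
qed

text \<open>Dropping \<open>(1 - x) ^ l\<close> costs at most \<open>1\<close> in
  \<open>x * pgf_defect l x\<close>, and \<open>1\<close> is at most half of
  \<open>l * x\<close>.\<close>

lemma pgf_defect_ge_half:
  assumes "0 < x" "x \<le> 1" "2 \<le> real l * x"
  shows "real l / 2 \<le> pgf_defect l x"
proof -
  have "x * (real l / 2) \<le> real l * x - 1"
    using assms(3) by (simp add: mult.commute)
  also have "\<dots> \<le> x * pgf_defect l x"
    using assms by (simp add: mult_pgf_defect)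
  finally show ?thesis
    using assms(1) by simp
qed

section \<open>Sums of the defect over powers of \<open>\<rho>\<close>\<close>

lemma sum_pgf_defect_powers_le:
  assumes "0 < \<rho>" "\<rho> < 1"
  shows "(\<Sum>k<n. pgf_defect l (\<rho> ^ k))
    \<le> (1 + 1 / (1 - \<rho>) + 1 / ln (1 / \<rho>)) * (real l + real l * log_plus (real l))"
proof (cases "l = 0")
  case True
  then show ?thesis by (simp add: pgf_defect_def)
next
  case False
  \<comment> \<open>This is the least index with \<open>l * \<rho> ^ K \<le> 1\<close>. Before it
    the trivial bound \<open>l\<close> is used; from it on, the quadratic bound gives a geometric
    series.\<close>
  define K where "K = nat \<lceil>ln (real l) / ln (1 / \<rho>)\<rceil>"
  have \<rho>: "0 < ln (1 / \<rho>)"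
    using assms by simp
  have ln: "0 \<le> ln (real l)" "log_plus (real l) = ln (real l)"
    using False by (auto simp: log_plus_def)
  have "ln (real l) / ln (1 / \<rho>) \<le> real K"
    unfolding K_def by linarith
  then have "ln (real l * \<rho> ^ K) \<le> 0"
    using \<rho> False assms by (simp add: ln_mult ln_realpow ln_div field_simps)
  then have lK: "real l * \<rho> ^ K \<le> 1"
    using False assms by (subst (asm) ln_le_zero_iff) simp_all
  have K: "real K \<le> ln (real l) / ln (1 / \<rho>) + 1"
    unfolding K_def using ln(1) \<rho> by (simp add: of_nat_nat)
  have head: "(\<Sum>k<K. pgf_defect l (\<rho> ^ k)) \<le> real l * real K"
  proof -
    have "(\<Sum>k<K. pgf_defect l (\<rho> ^ k)) \<le> (\<Sum>k<K. real l)"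
      using assms by (intro sum_mono pgf_defect_le) (simp add: power_le_one)
    then show ?thesis by (simp add: mult.commute)
  qed
  have tail: "pgf_defect l (\<rho> ^ (K + j)) \<le> real l * \<rho> ^ j" for j
  proof -
    have "pgf_defect l (\<rho> ^ (K + j)) \<le> real l * (real l * \<rho> ^ (K + j))"
      using assms by (intro pgf_defect_le_square) (auto simp: power_le_one)
    also have "\<dots> = real l * ((real l * \<rho> ^ K) * \<rho> ^ j)"
      by (simp add: power_add)
    also have "\<dots> \<le> real l * (1 * \<rho> ^ j)"
      using assms lK by (intro mult_left_mono mult_right_mono) auto
    finally show ?thesis by simp
  qed
  have "(\<Sum>k<K + n. pgf_defect l (\<rho> ^ k)) \<le> real l * real K + (\<Sum>j<n. real l * \<rho> ^ j)" for n
    by (induction n) (use head tail in \<open>auto intro: order_trans add_mono\<close>)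
  note this[of n]
  \<comment> \<open>Passing to the longer sum avoids a case distinction between \<open>n < K\<close>
    and \<open>K \<le> n\<close>.\<close>
  moreover have "(\<Sum>k<n. pgf_defect l (\<rho> ^ k)) \<le> (\<Sum>k<K + n. pgf_defect l (\<rho> ^ k))"
    using assms by (intro sum_mono2) (auto intro: pgf_defect_nonneg simp: power_le_one)
  moreover have "(\<Sum>j<n. real l * \<rho> ^ j) \<le> real l * (1 / (1 - \<rho>))"
    using assms
    by (auto simp: sum_gp_strict simp flip: sum_distrib_left intro!: mult_left_le divide_right_mono)
  moreover have "real l * real K \<le> real l * (ln (real l) / ln (1 / \<rho>) + 1)"
    using K by (intro mult_left_mono) auto
  \<comment> \<open>These are the surplus terms when the product on the right-hand side of the claim
    is expanded.\<close>
  moreover have "0 \<le> real l * (1 / ln (1 / \<rho>))" "0 \<le> real l * ln (real l)"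
      "0 \<le> real l * ln (real l) * (1 / (1 - \<rho>))"
    using \<rho> ln assms by auto
  ultimately show ?thesis
    by (simp add: ln(2) algebra_simps)
qed

text \<open>As long as \<open>l * \<rho> ^ k \<ge> 2\<close>, a term is at least
  \<open>l / 2\<close>, and there are about \<open>ln (l / 2) / ln (1 / \<rho>)\<close> such
  \<open>k\<close>. The index \<open>n\<close> may depend on \<open>l\<close>, since only the full
  series is needed later.\<close>

lemma sum_pgf_defect_powers_ge:
  assumes "0 < \<rho>" "\<rho> < 1"
  shows "\<exists>n. real l * log_plus (real l)
    \<le> (1 + 2 * ln (1 / \<rho>)) * (real l + (\<Sum>k<n. pgf_defect l (\<rho> ^ k)))"
proof -
  have \<rho>: "0 < ln (1 / \<rho>)"
    using assms by simp
  have ln2: "ln 2 \<le> (1::real)"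
    using ln_le_minus_one[of "2::real"] by simp
  show ?thesis
  proof (cases "l < 2")
    case True
    then have "l = 0 \<or> l = 1" by auto
    then have "real l * log_plus (real l) = 0"
      by (auto simp: log_plus_def)
    also have "0 \<le> (1 + 2 * ln (1 / \<rho>)) * (real l + (\<Sum>k<0. pgf_defect l (\<rho> ^ k)))"
      using \<rho> by simp
    finally show ?thesis by blast
  next
    case False
    \<comment> \<open>This is the last index with \<open>l * \<rho> ^ K \<ge> 2\<close>. Counting
      from \<open>0\<close> gives \<open>Suc K\<close> large terms, which makes up for the rounding
      down.\<close>
    define K where "K = nat \<lfloor>ln (real l / 2) / ln (1 / \<rho>)\<rfloor>"
    have nonneg: "0 \<le> ln (real l / 2) / ln (1 / \<rho>)"
      using False \<rho> by simp
    have K1: "real K \<le> ln (real l / 2) / ln (1 / \<rho>)"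
      unfolding K_def using nonneg by (simp add: of_nat_nat)
    have K2: "ln (real l / 2) / ln (1 / \<rho>) \<le> real (Suc K)"
      unfolding K_def using nonneg by (simp add: of_nat_nat) linarith
    have "ln (real l * \<rho> ^ K) \<ge> ln 2"
      using K1 \<rho> False assms by (simp add: ln_mult ln_realpow ln_div field_simps)
    then have lK: "2 \<le> real l * \<rho> ^ K"
      using False assms by (subst (asm) ln_le_cancel_iff) simp_all
    have "real l / 2 \<le> pgf_defect l (\<rho> ^ k)" if "k < Suc K" for k
    proof (rule pgf_defect_ge_half)
      have "real l * \<rho> ^ K \<le> real l * \<rho> ^ k"
        using that assms by (intro mult_left_mono power_decreasing) auto
      then show "2 \<le> real l * \<rho> ^ k"
        using lK by simp
    qed (use assms in \<open>auto simp: power_le_one\<close>)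
    then have "(\<Sum>k<Suc K. real l / 2) \<le> (\<Sum>k<Suc K. pgf_defect l (\<rho> ^ k))"
      by (intro sum_mono) auto
    then have *: "real (Suc K) * real l \<le> 2 * (\<Sum>k<Suc K. pgf_defect l (\<rho> ^ k))"
      by simp
    have "ln (real l / 2) \<le> real (Suc K) * ln (1 / \<rho>)"
      using K2 \<rho> by (simp add: field_simps)
    then have "real l * ln (real l / 2) \<le> real l * (real (Suc K) * ln (1 / \<rho>))"
      by (intro mult_left_mono) auto
    also have "\<dots> = ln (1 / \<rho>) * (real (Suc K) * real l)"
      by (simp only: mult_ac)
    also have "\<dots> \<le> ln (1 / \<rho>) * (2 * (\<Sum>k<Suc K. pgf_defect l (\<rho> ^ k)))"
      using * \<rho> by (intro mult_left_mono) auto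
    finally have "real l * ln (real l)
        \<le> real l * ln 2 + 2 * ln (1 / \<rho>) * (\<Sum>k<Suc K. pgf_defect l (\<rho> ^ k))"
      using False by (simp add: ln_div algebra_simps)
    \<comment> \<open>The loss from \<open>l / 2\<close> in place of \<open>l\<close> under the
      logarithm is absorbed by the summand \<open>l\<close> of the claim.\<close>
    moreover have "real l * ln 2 \<le> real l * 1"
      using ln2 by (intro mult_left_mono) auto
    moreover have "0 \<le> 2 * ln (1 / \<rho>) * real l" "0 \<le> (\<Sum>k<Suc K. pgf_defect l (\<rho> ^ k))"
      using \<rho> assms
      by (auto intro!: sum_nonneg pgf_defect_nonneg simp: power_le_one simp del: sum.lessThan_Suc)
    moreover have "log_plus (real l) = ln (real l)"
      using False by (auto simp: log_plus_def)
    ultimately show ?thesis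
      by (intro exI[of _ "Suc K"]) (simp add: algebra_simps del: sum.lessThan_Suc)
  qed
qed

text \<open>For each \<open>l\<close>, the series and \<open>l * log_plus l\<close> bound each other
  up to a constant factor and an added multiple of \<open>l\<close>; the latter is harmless because
  \<open>L\<close> has finite mean.\<close>

lemma nn_integral_sum_pgf_defect_finite_iff:
  assumes \<rho>: "0 < \<rho>" "\<rho> < 1"
    and [measurable]: "L \<in> N \<rightarrow>\<^sub>M count_space UNIV"
    and L: "integrable N (\<lambda>\<omega>. real (L \<omega>))"
  shows "(\<integral>\<^sup>+\<omega>. (\<Sum>k. ennreal (pgf_defect (L \<omega>) (\<rho> ^ k))) \<partial>N) < \<infinity> \<longleftrightarrow>
    (\<integral>\<^sup>+\<omega>. ennreal (real (L \<omega>) * log_plus (real (L \<omega>))) \<partial>N) < \<infinity>"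
proof -
  define S where "S l = (\<Sum>k. ennreal (pgf_defect l (\<rho> ^ k)))" for l
  define T where "T l = ennreal (real l * log_plus (real l))" for l
  have comp: "(\<integral>\<^sup>+\<omega>. V (L \<omega>) \<partial>N) < \<infinity>"
    if "\<And>l. V l \<le> ennreal C * (ennreal (real l) + U l)" and U: "(\<integral>\<^sup>+\<omega>. U (L \<omega>) \<partial>N) < \<infinity>"
    for U V :: "nat \<Rightarrow> ennreal" and C
  proof -
    have "(\<integral>\<^sup>+\<omega>. V (L \<omega>) \<partial>N) \<le> (\<integral>\<^sup>+\<omega>. ennreal C * (ennreal (real (L \<omega>)) + U (L \<omega>)) \<partial>N)"
      using that(1) by (intro nn_integral_mono) auto
    also have "\<dots> = ennreal C * ((\<integral>\<^sup>+\<omega>. ennreal (real (L \<omega>)) \<partial>N) + (\<integral>\<^sup>+\<omega>. U (L \<omega>) \<partial>N))"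
      by (subst nn_integral_cmult, measurable) (subst nn_integral_add, measurable)
    also have "\<dots> < \<infinity>"
      using U L by (auto simp: ennreal_mult_less_top integrable_iff_bounded)
    finally show ?thesis .
  qed
  have partial: "ennreal (\<Sum>k<n. pgf_defect l (\<rho> ^ k)) = (\<Sum>k<n. ennreal (pgf_defect l (\<rho> ^ k)))"
    for n l
    using \<rho> by (intro sum_ennreal [symmetric] pgf_defect_nonneg) (auto simp: power_le_one)
  have log: "0 \<le> log_plus x" for x
    by (simp add: log_plus_def)
  have "S l \<le> ennreal (1 + 1 / (1 - \<rho>) + 1 / ln (1 / \<rho>)) * (ennreal (real l) + T l)" for l
    unfolding S_def
  proof (rule suminf_le_const)
    fix n
    show "(\<Sum>k<n. ennreal (pgf_defect l (\<rho> ^ k)))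
        \<le> ennreal (1 + 1 / (1 - \<rho>) + 1 / ln (1 / \<rho>)) * (ennreal (real l) + T l)"
      unfolding T_def partial[symmetric]
      using sum_pgf_defect_powers_le[OF \<rho>, of l n] \<rho> log
      by (simp add: ennreal_mult'' flip: ennreal_plus ennreal_mult'' del: ennreal_plus)
  qed simp
  moreover have "T l \<le> ennreal (1 + 2 * ln (1 / \<rho>)) * (ennreal (real l) + S l)" for l
  proof -
    obtain n where n: "real l * log_plus (real l)
        \<le> (1 + 2 * ln (1 / \<rho>)) * (real l + (\<Sum>k<n. pgf_defect l (\<rho> ^ k)))"
      using sum_pgf_defect_powers_ge[OF \<rho>, of l] by blast
    have nonneg: "0 \<le> (\<Sum>k<n. pgf_defect l (\<rho> ^ k))"
      using \<rho> by (intro sum_nonneg pgf_defect_nonneg) (auto simp: power_le_one)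
    have "T l \<le> ennreal ((1 + 2 * ln (1 / \<rho>)) * (real l + (\<Sum>k<n. pgf_defect l (\<rho> ^ k))))"
      unfolding T_def using n by (rule ennreal_leI)
    also have "\<dots> = ennreal (1 + 2 * ln (1 / \<rho>))
        * (ennreal (real l) + (\<Sum>k<n. ennreal (pgf_defect l (\<rho> ^ k))))"
      using \<rho> nonneg by (simp add: ennreal_mult'' ennreal_plus partial)
    also have "\<dots> \<le> ennreal (1 + 2 * ln (1 / \<rho>)) * (ennreal (real l) + S l)"
      unfolding S_def by (intro mult_left_mono add_left_mono sum_le_suminf) auto
    finally show ?thesis .
  qed
  ultimately show ?thesis
    using comp[of S _ T] comp[of T _ S] unfolding S_def T_def by blast
qed

section \<open>The expected defect\<close>

context
  fixes N :: "'b measure" and L :: "'b \<Rightarrow> nat"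
  assumes L_meas [measurable]: "L \<in> N \<rightarrow>\<^sub>M count_space UNIV"
    and L_int: "integrable N (\<lambda>\<omega>. real (L \<omega>))"
begin

lemma integrable_pgf_defect:
  assumes "0 \<le> x" "x \<le> 1"
  shows "integrable N (\<lambda>\<omega>. pgf_defect (L \<omega>) x)"
  using L_int
proof (rule Bochner_Integration.integrable_bound)
  show "AE \<omega> in N. norm (pgf_defect (L \<omega>) x) \<le> norm (real (L \<omega>))"
    using assms by (simp add: pgf_defect_le pgf_defect_nonneg)
qed measurable

text \<open>Tonelli moves the sum inside the integral. The right-hand side does not involve
  \<open>\<rho>\<close>, so summability along one geometric sequence implies it along all of
  them.\<close>

lemma summable_pgf_defect_iff:
  assumes \<rho>: "0 < \<rho>" "\<rho> < 1"
  shows "summable (\<lambda>k. \<integral>\<omega>. pgf_defect (L \<omega>) (\<rho> ^ k) \<partial>N) \<longleftrightarrow>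
    (\<integral>\<^sup>+\<omega>. ennreal (real (L \<omega>) * log_plus (real (L \<omega>))) \<partial>N) < \<infinity>"
proof -
  have power: "0 \<le> \<rho> ^ k" "\<rho> ^ k \<le> 1" for k
    using \<rho> by (auto simp: power_le_one)
  have nonneg: "0 \<le> (\<integral>\<omega>. pgf_defect (L \<omega>) (\<rho> ^ k) \<partial>N)" for k
    using power by (intro Bochner_Integration.integral_nonneg pgf_defect_nonneg)
  have "(\<integral>\<^sup>+\<omega>. (\<Sum>k. ennreal (pgf_defect (L \<omega>) (\<rho> ^ k))) \<partial>N)
      = (\<Sum>k. \<integral>\<^sup>+\<omega>. ennreal (pgf_defect (L \<omega>) (\<rho> ^ k)) \<partial>N)"
    by (rule nn_integral_suminf) measurable
  also have "\<dots> = (\<Sum>k. ennreal (\<integral>\<omega>. pgf_defect (L \<omega>) (\<rho> ^ k) \<partial>N))"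
    using power
    by (simp add: nn_integral_eq_integral integrable_pgf_defect pgf_defect_nonneg)
  also have "\<dots> < \<infinity> \<longleftrightarrow> summable (\<lambda>k. \<integral>\<omega>. pgf_defect (L \<omega>) (\<rho> ^ k) \<partial>N)"
    unfolding infinity_ennreal_def less_top[symmetric]
    by (rule iffI, erule summable_suminf_not_top[rotated], rule nonneg,
        erule ennreal_suminf_neq_top, rule nonneg)
  finally show ?thesis
    using nn_integral_sum_pgf_defect_finite_iff[OF \<rho> L_meas L_int] by simp
qed

end

lemma (in prob_space) expectation_one_minus_power:
  assumes [measurable]: "L \<in> M \<rightarrow>\<^sub>M count_space UNIV" and L: "integrable M (\<lambda>\<omega>. real (L \<omega>))"
    and x: "0 \<le> x" "x \<le> 1"
  shows "expectation (\<lambda>\<omega>. (1 - x) ^ L \<omega>)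
    = 1 - x * (expectation (\<lambda>\<omega>. real (L \<omega>)) - expectation (\<lambda>\<omega>. pgf_defect (L \<omega>) x))"
proof -
  have "(1 - x) ^ L \<omega> = 1 - x * (real (L \<omega>) - pgf_defect (L \<omega>) x)" for \<omega>
    using mult_pgf_defect[of x "L \<omega>"] by (simp add: algebra_simps)
  then show ?thesis
    using L integrable_pgf_defect[OF assms] by (simp add: prob_space)
qed

subsection \<open>The iteration of survival probabilities\<close>

text \<open>This isolates the real recursion from the probability: \<open>q\<close> is the survival
  probability, \<open>h\<close> the expected defect and \<open>a\<close> the probability of having
  children. The bound on \<open>h\<close> keeps the factors \<open>m - h (q n)\<close> at least
  \<open>a\<close>, hence away from \<open>0\<close>.\<close>

locale subcritical_iteration =
  fixes a m :: real and h :: "real \<Rightarrow> real" and q :: "nat \<Rightarrow> real"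
  assumes a: "0 < a" and m: "m < 1"
    and h_nonneg: "\<And>x. 0 \<le> x \<Longrightarrow> x \<le> 1 \<Longrightarrow> 0 \<le> h x"
    and h_mono: "\<And>x y. 0 \<le> x \<Longrightarrow> x \<le> y \<Longrightarrow> y \<le> 1 \<Longrightarrow> h x \<le> h y"
    and h_le: "\<And>x. 0 \<le> x \<Longrightarrow> x \<le> 1 \<Longrightarrow> h x \<le> m - a"
    and q_0: "q 0 = 1"
    and q_Suc: "\<And>n. q (Suc n) = q n * (m - h (q n))"
begin

lemma a_le_m: "a \<le> m"
  using h_nonneg[of 1] h_le[of 1] by simp

lemma m_pos: "0 < m"
  using a a_le_m by simp

lemma q_bounds: "a ^ n \<le> q n \<and> q n \<le> m ^ n"
proof (induction n)
  case 0
  then show ?case by (simp add: q_0)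
next
  case (Suc n)
  have "0 < a ^ n" "m ^ n \<le> 1"
    using a m a_le_m by (auto simp: power_le_one)
  then have q: "0 < q n" "q n \<le> 1"
    using Suc by linarith+
  then have "0 \<le> h (q n)" "a \<le> m - h (q n)"
    using h_nonneg[of "q n"] h_le[of "q n"] by auto
  then have "a ^ n * a \<le> q n * (m - h (q n))" "q n * (m - h (q n)) \<le> m ^ n * m"
    using Suc a q by (auto intro!: mult_mono)
  then show ?case
    by (simp add: q_Suc mult.commute)
qed

lemma q_pos: "0 < q n" and q_le_1: "q n \<le> 1"
proof -
  have "0 < a ^ n" "m ^ n \<le> 1"
    using a m a_le_m by (auto simp: power_le_one)
  then show "0 < q n" "q n \<le> 1"
    using q_bounds[of n] by linarith+
qed

lemma h_q: "0 \<le> h (q n)" "a \<le> m - h (q n)"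
  using h_nonneg[of "q n"] h_le[of "q n"] q_pos[of n] q_le_1[of n] by auto

text \<open>The ratio is the product of the factors \<open>m / (m - h (q k))\<close>. Each is at
  least \<open>1 + h (q k) / m\<close>, because \<open>(1 + t) * (1 - t) \<le> 1\<close>, and such a
  product dominates \<open>1\<close> plus the sum.\<close>

lemma ratio_ge: "1 + (\<Sum>k<n. h (q k)) / m \<le> m ^ n / q n"
proof (induction n)
  case 0
  then show ?case by (simp add: q_0)
next
  case (Suc n)
  have d: "0 < m - h (q n)"
    using h_q(2)[of n] a by linarith
  have "(1 + h (q n) / m) * (m - h (q n)) \<le> m"
    using m_pos by (simp add: field_simps)
  then have step: "1 + h (q n) / m \<le> m / (m - h (q n))"
    using d by (simp add: pos_le_divide_eq)
  have one: "1 \<le> m ^ n / q n"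
    using q_bounds[of n] q_pos[of n] by simp
  have "0 \<le> h (q n) / m"
    using h_q(1) m_pos by simp
  then have "1 * (h (q n) / m) \<le> m ^ n / q n * (h (q n) / m)"
    using one by (intro mult_right_mono)
  then have "m ^ n / q n + h (q n) / m \<le> m ^ n / q n * (1 + h (q n) / m)"
    by (simp add: distrib_left)
  also have "\<dots> \<le> m ^ n / q n * (m / (m - h (q n)))"
    using step one by (intro mult_left_mono) auto
  also have "\<dots> = m ^ Suc n / q (Suc n)"
    by (simp add: q_Suc mult.commute)
  finally show ?case
    using Suc by (simp add: add_divide_distrib)
qed

text \<open>Each factor is \<open>1 + h (q k) / (m - h (q k))\<close>; its denominator is at least
  \<open>a\<close>, and \<open>1 + t \<le> exp t\<close>.\<close>

lemma ratio_le: "m ^ n / q n \<le> exp ((\<Sum>k<n. h (q k)) / a)"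
proof (induction n)
  case 0
  then show ?case by (simp add: q_0)
next
  case (Suc n)
  have d: "0 < m - h (q n)"
    using h_q(2)[of n] a by linarith
  have "m / (m - h (q n)) = 1 + h (q n) / (m - h (q n))"
    using d by (simp add: field_simps)
  also have "\<dots> \<le> 1 + h (q n) / a"
    using h_q[of n] a by (intro add_left_mono divide_left_mono) (auto intro: mult_pos_pos)
  also have "\<dots> \<le> exp (h (q n) / a)"
    by (rule exp_ge_add_one_self)
  finally have "m ^ n / q n * (m / (m - h (q n))) \<le> exp ((\<Sum>k<n. h (q k)) / a) * exp (h (q n) / a)"
    using Suc d m_pos by (intro mult_mono) auto
  then show ?case
    by (simp add: q_Suc mult.commute add_divide_distrib exp_add)
qed

text \<open>The unknown \<open>q k\<close> is replaced by its geometric lower bound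
  \<open>a ^ k\<close>, which only decreases \<open>h\<close>; the converse direction uses the upper
  bound \<open>m ^ k\<close>.\<close>

lemma summable_if_ratio_bounded:
  assumes "\<And>n. m ^ n / q n \<le> B"
  shows "summable (\<lambda>k. h (a ^ k))"
proof (rule summableI_nonneg_bounded)
  show "0 \<le> h (a ^ k)" for k
    using a a_le_m m by (intro h_nonneg) (auto simp: power_le_one)
  have "(\<Sum>k<n. h (a ^ k)) \<le> (\<Sum>k<n. h (q k))" for n
    using a q_bounds q_le_1 by (intro sum_mono h_mono) auto
  moreover have "(\<Sum>k<n. h (q k)) \<le> B * m" for n
  proof -
    have "(\<Sum>k<n. h (q k)) / m \<le> B"
      using ratio_ge[of n] assms[of n] by linarith
    then show ?thesis
      using m_pos by (simp add: field_simps)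
  qed
  ultimately show "(\<Sum>k<n. h (a ^ k)) \<le> B * m" for n
    by (rule order_trans)
qed

lemma ratio_bounded_if_summable:
  assumes "summable (\<lambda>k. h (m ^ k))"
  shows "m ^ n / q n \<le> exp ((\<Sum>k. h (m ^ k)) / a)"
proof -
  have "(\<Sum>k<n. h (q k)) \<le> (\<Sum>k<n. h (m ^ k))"
    using m m_pos q_bounds q_pos by (intro sum_mono h_mono) (auto simp: power_le_one less_imp_le)
  also have "\<dots> \<le> (\<Sum>k. h (m ^ k))"
    using assms m m_pos by (intro sum_le_suminf) (auto intro!: h_nonneg simp: power_le_one)
  finally have "(\<Sum>k<n. h (q k)) / a \<le> (\<Sum>k. h (m ^ k)) / a"
    using a by (intro divide_right_mono) auto
  then show ?thesis
    using ratio_le[of n] by (meson exp_le_cancel_iff order_trans)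
qed

end

subsection \<open>The limit theorem\<close>

theorem theoremB:
  fixes M :: "'a measure" and X :: "nat \<Rightarrow> nat \<Rightarrow> 'a \<Rightarrow> nat"
    and N :: "'b measure" and L :: "'b \<Rightarrow> nat"
    and m :: real and Z :: "nat \<Rightarrow> 'a \<Rightarrow> nat"
  assumes "prob_space N" and "L \<in> measurable N (count_space UNIV)"
    and "integrable N (\<lambda>\<omega>. real (L \<omega>))"
    and "m = prob_space.expectation N (\<lambda>\<omega>. real (L \<omega>))" and "0 < m"
    and "prob_space M" and "iid_copies M X N L"
    and "Z = galton_watson X"
  shows "decseq (\<lambda>n. \<P>(\<omega> in M. Z n \<omega> > 0) / m ^ n) \<and>
    (m < 1 \<longrightarrow>
      ((\<exists>c>0. (\<lambda>n. \<P>(\<omega> in M. Z n \<omega> > 0) / m ^ n) \<longlonglongrightarrow> c) \<longleftrightarrow>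
       (SUP n. cond_nn_expectation M (\<lambda>\<omega>. of_nat (Z n \<omega>)) (\<lambda>\<omega>. Z n \<omega> > 0)) < \<infinity>) \<and>
      ((SUP n. cond_nn_expectation M (\<lambda>\<omega>. of_nat (Z n \<omega>)) (\<lambda>\<omega>. Z n \<omega> > 0)) < \<infinity> \<longleftrightarrow>
       (\<integral>\<^sup>+\<omega>. ennreal (real (L \<omega>) * log_plus (real (L \<omega>))) \<partial>N) < \<infinity>))"
proof -
  interpret N: prob_space N by fact
  interpret M: prob_space M by fact
  note [measurable] = assms(2)
  have [measurable]: "X n i \<in> M \<rightarrow>\<^sub>M count_space UNIV" for n i
  proof -
    have "(case (n, i) of (n, i) \<Rightarrow> X n i) \<in> M \<rightarrow>\<^sub>M count_space UNIV"
      using assms(7) unfolding iid_copies_def M.indep_vars_def by blast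
    then show ?thesis by simp
  qed
  have [measurable]: "Z n \<in> M \<rightarrow>\<^sub>M count_space UNIV" for n
    unfolding assms(8) by (rule galton_watson_measurable) simp
  define q where "q n = \<P>(\<omega> in M. Z n \<omega> > 0)" for n
  define H where "H x = N.expectation (\<lambda>\<omega>. pgf_defect (L \<omega>) x)" for x
  define a where "a = \<P>(\<omega> in N. L \<omega> > 0)"
  define r where "r n = q n / m ^ n" for n
  define E where "E n = cond_nn_expectation M (\<lambda>\<omega>. of_nat (Z n \<omega>)) (\<lambda>\<omega>. Z n \<omega> > 0)" for n

  have q_range: "0 \<le> q n" "q n \<le> 1" for n
    by (auto simp: q_def)
  \<comment> \<open>At \<open>s = 0\<close> the convention \<open>0 ^ 0 = 1\<close> turns the
    generating function into the probability of extinction by generation \<open>n\<close>.\<close>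
  have pgf_0: "((\<lambda>t. \<integral>\<^sup>+\<omega>. t ^ L \<omega> \<partial>N) ^^ n) 0 = ennreal (1 - q n)" for n
  proof -
    have "((\<lambda>t. \<integral>\<^sup>+\<omega>. t ^ L \<omega> \<partial>N) ^^ n) 0 = (\<integral>\<^sup>+\<omega>. 0 ^ Z n \<omega> \<partial>M)"
      unfolding assms(8) using assms by (intro galton_watson_pgf [symmetric])
    also have "\<dots> = (\<integral>\<^sup>+\<omega>. indicator {\<omega> \<in> space M. \<not> Z n \<omega> > 0} \<omega> \<partial>M)"
      by (intro nn_integral_cong) (auto simp: indicator_def power_0_left)
    also have "\<dots> = ennreal (1 - q n)"
      by (simp add: M.emeasure_eq_measure q_def flip: M.prob_neg)
    finally show ?thesis .
  qed
  have q_Suc: "q (Suc n) = q n * (m - H (q n))" for n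
  proof -
    have "ennreal (1 - q (Suc n)) = (\<integral>\<^sup>+\<omega>. ennreal (1 - q n) ^ L \<omega> \<partial>N)"
      unfolding pgf_0[symmetric] by simp
    also have "\<dots> = (\<integral>\<^sup>+\<omega>. ennreal ((1 - q n) ^ L \<omega>) \<partial>N)"
      using q_range by (simp add: ennreal_power)
    also have "\<dots> = ennreal (N.expectation (\<lambda>\<omega>. (1 - q n) ^ L \<omega>))"
      using q_range
      by (intro nn_integral_eq_integral N.integrable_const_bound[of _ 1])
        (auto simp: power_le_one)
    also have "\<dots> = ennreal (1 - q n * (m - H (q n)))"
      using assms(2,3) q_range by (simp add: N.expectation_one_minus_power H_def assms(4))
    finally have "ennreal (1 - q (Suc n)) = ennreal (1 - q n * (m - H (q n)))" .
    \<comment> \<open>\<open>ennreal\<close> sends all negative reals to \<open>0\<close>, so both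
      sides must be nonnegative before it can be cancelled.\<close>
    moreover have "0 \<le> 1 - q n * (m - H (q n))"
    proof -
      have "0 \<le> N.expectation (\<lambda>\<omega>. (1 - q n) ^ L \<omega>)"
        using q_range by (intro Bochner_Integration.integral_nonneg) simp
      then show ?thesis
        using assms(2,3) q_range by (simp add: N.expectation_one_minus_power H_def assms(4))
    qed
    ultimately show ?thesis
      using q_range[of "Suc n"] by simp
  qed
  have H_nonneg: "0 \<le> H x" if "0 \<le> x" "x \<le> 1" for x
    unfolding H_def using that by (intro Bochner_Integration.integral_nonneg pgf_defect_nonneg)
  have decseq: "decseq r"
  proof (rule decseq_SucI)
    fix n
    have "q n * (m - H (q n)) / m ^ Suc n \<le> q n * m / m ^ Suc n"
      using q_range[of n] H_nonneg[of "q n"] assms(5)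
      by (intro divide_right_mono mult_left_mono) auto
    then show "r (Suc n) \<le> r n"
      using assms(5) by (simp add: r_def q_Suc)
  qed

  have main: "((\<exists>c>0. r \<longlonglongrightarrow> c) \<longleftrightarrow> (SUP n. E n) < \<infinity>) \<and>
      ((SUP n. E n) < \<infinity> \<longleftrightarrow>
       (\<integral>\<^sup>+\<omega>. ennreal (real (L \<omega>) * log_plus (real (L \<omega>))) \<partial>N) < \<infinity>)"
    if "m < 1"
  proof -
    \<comment> \<open>At \<open>x = 1\<close> only the term \<open>j = 0\<close> of the defect
      vanishes and the others are \<open>1\<close>, which leaves \<open>l - 1\<close> for
      \<open>l > 0\<close> and \<open>0\<close> for \<open>l = 0\<close>.\<close>
    have H_1: "H 1 = m - a"
    proof -
      have "pgf_defect (L \<omega>) 1 = real (L \<omega>) - indicator {\<omega> \<in> space N. L \<omega> > 0} \<omega>"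
        if "\<omega> \<in> space N" for \<omega>
        using mult_pgf_defect[of 1 "L \<omega>"] that by (auto simp: indicator_def power_0_left)
      then have "H 1 = N.expectation (\<lambda>\<omega>. real (L \<omega>) - indicator {\<omega> \<in> space N. L \<omega> > 0} \<omega>)"
        unfolding H_def by (intro Bochner_Integration.integral_cong) auto
      also have "\<dots> = m - a"
        using assms(3) by (simp add: assms(4) a_def N.emeasure_eq_measure)
      finally show ?thesis .
    qed
    have a_pos: "0 < a"
    proof (rule ccontr)
      assume "\<not> 0 < a"
      then have "a = 0"
        by (simp add: a_def order.antisym)
      then have "AE \<omega> in N. \<not> L \<omega> > 0"
        by (simp add: a_def N.prob_Collect_eq_0)
      then have "m = N.expectation (\<lambda>\<omega>. 0)"
        unfolding assms(4) by (intro integral_cong_AE) auto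
      then show False
        using assms(5) by simp
    qed
    have H_mono: "H x \<le> H y" if "0 \<le> x" "x \<le> y" "y \<le> 1" for x y
      unfolding H_def using that assms(2,3)
      by (intro Bochner_Integration.integral_mono integrable_pgf_defect pgf_defect_mono) auto
    interpret subcritical_iteration a m H q
    proof
      show "H x \<le> m - a" if "0 \<le> x" "x \<le> 1" for x
        using H_mono[of x 1] that H_1 by simp
      show "q 0 = 1"
        by (simp add: q_def assms(8) M.prob_space)
    qed (use that a_pos H_nonneg H_mono q_Suc in auto)
    have mean: "(\<integral>\<^sup>+\<omega>. of_nat (Z n \<omega>) \<partial>M) = ennreal (m ^ n)" for n
    proof -
      have "(\<integral>\<^sup>+\<omega>. of_nat (L \<omega>) \<partial>N) = ennreal m"
        using nn_integral_eq_integral[OF assms(3)] by (simp add: assms(4) ennreal_of_nat_eq_real_of_nat)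
      then show ?thesis
        unfolding assms(8) using nn_integral_galton_watson[OF assms(6,7,2)] m_pos
        by (simp add: ennreal_power)
    qed
    have E: "E n = ennreal (m ^ n / q n)" for n
    proof -
      have "E n = (\<integral>\<^sup>+\<omega>. of_nat (Z n \<omega>) * indicator {\<omega> \<in> space M. Z n \<omega> > 0} \<omega> \<partial>M)
          / emeasure M {\<omega> \<in> space M. Z n \<omega> > 0}"
        unfolding E_def cond_nn_expectation_def by (rule nn_integral_uniform_measure) measurable
      also have "(\<integral>\<^sup>+\<omega>. of_nat (Z n \<omega>) * indicator {\<omega> \<in> space M. Z n \<omega> > 0} \<omega> \<partial>M)
          = (\<integral>\<^sup>+\<omega>. of_nat (Z n \<omega>) \<partial>M)"
        by (intro nn_integral_cong) (auto simp: indicator_def)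
      finally show ?thesis
        using q_pos[of n] m_pos by (simp add: mean divide_ennreal M.emeasure_eq_measure flip: q_def)
    qed
    have SUP_E: "(SUP n. E n) < \<infinity> \<longleftrightarrow> (\<exists>B. \<forall>n. m ^ n / q n \<le> B)"
    proof
      assume "(SUP n. E n) < \<infinity>"
      then obtain B where B: "(SUP n. E n) = ennreal B" "0 \<le> B"
        by (cases "SUP n. E n") auto
      then have "ennreal (m ^ n / q n) \<le> ennreal B" for n
        unfolding E[symmetric] by (metis SUP_upper UNIV_I)
      then show "\<exists>B. \<forall>n. m ^ n / q n \<le> B"
        using B(2) by auto
    next
      assume "\<exists>B. \<forall>n. m ^ n / q n \<le> B"
      then obtain B where "\<And>n. m ^ n / q n \<le> B"
        by blast
      then have "(SUP n. E n) \<le> ennreal B"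
        by (intro SUP_least) (simp add: E ennreal_leI)
      then show "(SUP n. E n) < \<infinity>"
        by (simp add: order_le_less_trans)
    qed
    have "(\<exists>c>0. r \<longlonglongrightarrow> c) \<longleftrightarrow> (\<exists>B. \<forall>n. m ^ n / q n \<le> B)"
    proof
      assume "\<exists>c>0. r \<longlonglongrightarrow> c"
      then obtain c where c: "0 < c" "r \<longlonglongrightarrow> c"
        by blast
      have "m ^ n / q n \<le> 1 / c" for n
        using decseq_ge[OF decseq c(2), of n] c(1) q_pos[of n] m_pos by (simp add: r_def field_simps)
      then show "\<exists>B. \<forall>n. m ^ n / q n \<le> B"
        by blast
    next
      assume "\<exists>B. \<forall>n. m ^ n / q n \<le> B"
      then obtain B where B: "\<And>n. m ^ n / q n \<le> B"
        by blast
      \<comment> \<open>At \<open>n = 0\<close> the ratio equals \<open>1\<close>, so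
        \<open>B \<ge> 1\<close>.\<close>
      have B_pos: "0 < B"
        using B[of 0] q_0 by simp
      have r: "1 / B \<le> r n" for n
        using B[of n] B_pos q_pos[of n] m_pos by (simp add: r_def field_simps)
      obtain c where c: "r \<longlonglongrightarrow> c"
        using decseq_convergent[OF decseq, of "1 / B"] r by blast
      have "1 / B \<le> c"
        using r by (intro LIMSEQ_le_const[OF c]) auto
      then have "0 < c"
        using B_pos by (meson order_less_le_trans zero_less_divide_1_iff)
      then show "\<exists>c>0. r \<longlonglongrightarrow> c"
        using c by blast
    qed
    \<comment> \<open>The two directions use different geometric rates, \<open>a\<close> and
      \<open>m\<close>; they meet because the moment condition characterises summability for every
      rate in \<open>(0, 1)\<close>.\<close>
    moreover have "(\<exists>B. \<forall>n. m ^ n / q n \<le> B) \<longleftrightarrow>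
        (\<integral>\<^sup>+\<omega>. ennreal (real (L \<omega>) * log_plus (real (L \<omega>))) \<partial>N) < \<infinity>" (is "?B \<longleftrightarrow> ?L")
    proof
      assume ?B
      then have "summable (\<lambda>k. H (a ^ k))"
        using summable_if_ratio_bounded by blast
      then show ?L
        unfolding H_def using summable_pgf_defect_iff[OF assms(2,3), of a] a_pos a_le_m m by simp
    next
      assume ?L
      then have "summable (\<lambda>k. H (m ^ k))"
        unfolding H_def using summable_pgf_defect_iff[OF assms(2,3), of m] m_pos m by simp
      then show ?B
        using ratio_bounded_if_summable by blast
    qed
    ultimately show ?thesis
      unfolding SUP_E by simp
  qed
  show ?thesis
    using decseq main unfolding r_def q_def E_def by blast
qed

end
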